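(* Let $1<\alpha<2$, let $\beta_2\in[-1,1]$, and let $Z_1,Z_2$ be independent standard normal random variables. Then for every $x\in(-\infty,\infty)$ the function $\mathbf 1\{G_0(Z_1,Z_2)\le x\}$ has Hermite rank $m(x)=1$, and its Hermite coefficients of total degree one are as follows. (a) For $x\ge0$, $$J_{1,0}(x,\beta_2)=-\frac1\pi\int_{\gamma_0}^{\pi/2} e^{-x^{\frac{\alpha}{\alpha-1}}a(\gamma)}\,\Phi^{-1}\!\left(\tfrac1\pi\left(\gamma+\tfrac\pi2\right)\right)d\gamma,$$ $$J_{0,1}(x,\beta_2)=-\frac1\pi\int_{\gamma_0}^{\pi/2}(\phi\circ\Phi^{-1})\!\left(1-e^{-x^{\frac{\alpha}{\alpha-1}}a(\gamma)}\right)d\gamma .$$ (b) For $x<0$, $$J_{1,0}(x,\beta_2)=J_{1,0}(-x,-\beta_2),\qquad J_{0,1}(x,\beta_2)=-J_{0,1}(-x,-\beta_2),$$ where the right-hand sides are given by the formulas in (a) with $\beta_2$ replaced by $-\beta_2$ (also in $\gamma_0$ and $a$) and $x$ replaced by $-x$.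
   Context: $\phi$ and $\Phi$ denote the density and cumulative distribution function of the standard normal distribution; $\phi\circ\Phi^{-1}$ is extended by continuity to $[0,1]$, i.e. $(\phi\circ\Phi^{-1})(0)=(\phi\circ\Phi^{-1})(1)=0$. For $z_1,z_2\in\mathbb{R}$ put $$\gamma(z_1)=\pi\Phi(z_1)-\tfrac{\pi}{2},\qquad W(z_2)=-\log(1-\Phi(z_2)).$$ For $0<\alpha<2$, $\alpha\ne1$, and $\beta_2\in[-1,1]$ let $K(\alpha)=\alpha-1+\operatorname{sign}(1-\alpha)$ and $$\gamma_0=\gamma_0(\beta_2)=-\beta_2\frac{\pi K(\alpha)}{2\alpha},$$ $$G_0(z_1,z_2)=\frac{\sin(\alpha(\gamma(z_1)-\gamma_0))}{(\cos\gamma(z_1))^{1/\alpha}}\left(\frac{\cos(\gamma(z_1)-\alpha(\gamma(z_1)-\gamma_0))}{W(z_2)}\right)^{(1-\alpha)/\alpha},$$ $$a(\gamma)=\left(\frac{\sin\alpha(\gamma-\gamma_0)}{\cos\gamma}\right)^{\frac{\alpha}{1-\alpha}}\frac{\cos(\gamma-\alpha(\gamma-\gamma_0))}{\cos\gamma},\qquad \gamma_0<\gamma<\tfrac{\pi}{2}.$$ (The random variable $G_0(Z_1,Z_2)$ is $\alpha$-stable with asymmetry parameter $\beta_2$.) The Hermite polynomials are $H_m(u)=(-1)^m\phi(u)^{-1}\frac{d^m}{du^m}\phi(u)$, so $H_0=1$, $H_1(u)=u$. The Hermite coefficients are $$J_{m_1,m_2}(x,\beta_2)=\mathrm{E}\left[\mathbf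 1\{G_0(Z_1,Z_2)\le x\}\,H_{m_1}(Z_1)H_{m_2}(Z_2)\right],\qquad m_1,m_2\ge0,$$ and the Hermite rank is $m(x)=\min\{m_1+m_2\ge1: J_{m_1,m_2}(x,\beta_2)\ne0\}$. *)

theory Defs
  imports "HOL-Probability.Probability"
begin

abbreviation Phi :: "real \<Rightarrow> real" where
  "Phi \<equiv> cdf std_normal_distribution"

lemma DERIV_std_normal_density:
  "(std_normal_density has_real_derivative - u * std_normal_density u) (at u)"
proof -
  have "((\<lambda>u. 1 / sqrt (2 * pi) * exp (- u\<^sup>2 / 2)) has_real_derivative
      1 / sqrt (2 * pi) * (exp (- u\<^sup>2 / 2) * - u)) (at u)"
    by (intro DERIV_cmult) (auto intro!: derivative_eq_intros)
  moreover have "std_normal_density = (\<lambda>u. 1 / sqrt (2 * pi) * exp (- u\<^sup>2 / 2))"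
    by (simp add: fun_eq_iff std_normal_density_def)
  ultimately show ?thesis
    by (simp add: mult_ac)
qed

lemma Phi_strict_mono: "strict_mono Phi"
proof (rule strict_monoI)
  fix a b :: real assume ab: "a < b"
  interpret D: real_distribution std_normal_distribution
    by (rule real_dist_normal_dist)
  have "\<not> (AE t in lborel. t \<notin> {a<..b})"
  proof
    assume "AE t in lborel. t \<notin> {a<..b}"
    then have "emeasure lborel {a<..b} = 0"
      by (subst (asm) AE_iff_measurable[where N = "{a<..b}"]) auto
    with ab show False by simp
  qed
  then have "\<not> (AE t in lborel. 0 < ennreal (std_normal_density t) \<longrightarrow> t \<notin> {a<..b})"
    by (simp add: std_normal_density_def)
  then have "\<not> (AE t in std_normal_distribution. t \<notin> {a<..b})"
    by (subst AE_density) auto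
  then have "measure std_normal_distribution {a<..b} \<noteq> 0"
    by (subst D.prob_eq_0) auto
  then have "0 < measure std_normal_distribution {a<..b}"
    by (simp add: zero_less_measure_iff)
  then show "Phi a < Phi b"
    using D.cdf_diff_eq[OF ab] by simp
qed

text \<open>Hence the quantile function is \<^term>\<open>inv Phi\<close>, used on the open unit interval only.\<close>

lemma Phi_range: "range Phi = {0<..<1}"
proof -
  interpret D: real_distribution std_normal_distribution
    by (rule real_dist_normal_dist)
  have cont: "continuous_on UNIV Phi"
  proof (rule continuous_at_imp_continuous_on, intro ballI)
    fix x :: real
    have "emeasure std_normal_distribution {x} = 0"
      by (subst emeasure_density) (auto intro!: nn_integral_null_set simp: null_sets_def)
    then show "isCont Phi x"
      by (simp add: D.isCont_cdf measure_def)
  qed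
  show ?thesis
  proof (intro equalityI subsetI)
    fix p assume "p \<in> range Phi"
    then obtain x where p: "p = Phi x" by auto
    have "Phi (x - 1) < Phi x" "Phi x < Phi (x + 1)"
      using Phi_strict_mono by (auto simp: strict_mono_def)
    then show "p \<in> {0<..<1}"
      using p D.cdf_nonneg[of "x - 1"] D.cdf_bounded_prob[of "x + 1"] by auto
  next
    fix p :: real assume p: "p \<in> {0<..<1}"
    obtain a where a: "Phi a < p"
      using order_tendstoD(2)[OF D.cdf_lim_at_bot, of p] p
      by (auto simp: eventually_at_bot_linorder)
    obtain b where b: "p < Phi b"
      using order_tendstoD(1)[OF D.cdf_lim_at_top_prob, of p] p
      by (auto simp: eventually_at_top_linorder)
    have "a \<le> b"
      using a b Phi_strict_mono by (meson less_trans linorder_not_less not_less_iff_gr_or_eq strict_mono_less)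
    then show "p \<in> range Phi"
      using IVT'[of Phi a p b] a b cont by (force intro: continuous_on_subset)
  qed
qed

text \<open>The density at the quantile, extended by continuity to the closed unit interval.\<close>

definition phi_quantile :: "real \<Rightarrow> real" where
  "phi_quantile p = (if 0 < p \<and> p < 1 then std_normal_density (inv Phi p) else 0)"

definition hermite :: "nat \<Rightarrow> real \<Rightarrow> real" where
  "hermite m u =
     (-1) ^ m * inverse (std_normal_density u) * (deriv ^^ m) std_normal_density u"

lemma hermite_0: "hermite 0 u = 1"
  using normal_density_pos[of 1 0 u] by (simp add: hermite_def)

lemma hermite_1: "hermite 1 u = u"
  using normal_density_pos[of 1 0 u] DERIV_imp_deriv[OF DERIV_std_normal_density[of u]]
  by (simp add: hermite_def)

definition gam :: "real \<Rightarrow> real" where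
  "gam z1 = pi * Phi z1 - pi / 2"

definition W :: "real \<Rightarrow> real" where
  "W z2 = - ln (1 - Phi z2)"

definition K :: "real \<Rightarrow> real" where
  "K \<alpha> = \<alpha> - 1 + sgn (1 - \<alpha>)"

definition gam0 :: "real \<Rightarrow> real \<Rightarrow> real" where
  "gam0 \<alpha> \<beta> = - \<beta> * (pi * K \<alpha> / (2 * \<alpha>))"

text \<open>
  For \<^term>\<open>0 < \<alpha>\<close>, \<^term>\<open>\<alpha> < 2\<close>, \<^term>\<open>\<alpha> \<noteq> 1\<close> and \<^term>\<open>\<bar>\<beta>\<bar> \<le> 1\<close>, the bases of the real powers below
  are positive: in \<open>G0\<close> for all arguments, in \<open>a_fun\<close> for \<^term>\<open>gam0 \<alpha> \<beta> < \<gamma>\<close> and \<^term>\<open>\<gamma> < pi / 2\<close>.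
\<close>

definition G0 :: "real \<Rightarrow> real \<Rightarrow> real \<Rightarrow> real \<Rightarrow> real" where
  "G0 \<alpha> \<beta> z1 z2 =
     sin (\<alpha> * (gam z1 - gam0 \<alpha> \<beta>)) / cos (gam z1) powr (1 / \<alpha>)
     * (cos (gam z1 - \<alpha> * (gam z1 - gam0 \<alpha> \<beta>)) / W z2) powr ((1 - \<alpha>) / \<alpha>)"

definition a_fun :: "real \<Rightarrow> real \<Rightarrow> real \<Rightarrow> real" where
  "a_fun \<alpha> \<beta> \<gamma> =
     (sin (\<alpha> * (\<gamma> - gam0 \<alpha> \<beta>)) / cos \<gamma>) powr (\<alpha> / (1 - \<alpha>))
     * (cos (\<gamma> - \<alpha> * (\<gamma> - gam0 \<alpha> \<beta>)) / cos \<gamma>)"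

definition hermite_coeff ::
  "'a measure \<Rightarrow> ('a \<Rightarrow> real) \<Rightarrow> ('a \<Rightarrow> real) \<Rightarrow> real \<Rightarrow> nat \<Rightarrow> nat \<Rightarrow> real \<Rightarrow> real \<Rightarrow> real" where
  "hermite_coeff M Z1 Z2 \<alpha> m1 m2 x \<beta> =
     (\<integral>\<omega>. indicator {..x} (G0 \<alpha> \<beta> (Z1 \<omega>) (Z2 \<omega>))
          * hermite m1 (Z1 \<omega>) * hermite m2 (Z2 \<omega>) \<partial>M)"

text \<open>The value is \<^term>\<open>\<infinity> :: enat\<close> if all coefficients of positive total degree vanish.\<close>

definition hermite_rank ::
  "'a measure \<Rightarrow> ('a \<Rightarrow> real) \<Rightarrow> ('a \<Rightarrow> real) \<Rightarrow> real \<Rightarrow> real \<Rightarrow> real \<Rightarrow> enat" where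
  "hermite_rank M Z1 Z2 \<alpha> x \<beta> =
     Inf {enat (m1 + m2) | m1 m2. 1 \<le> m1 + m2 \<and> hermite_coeff M Z1 Z2 \<alpha> m1 m2 x \<beta> \<noteq> 0}"

end

theory Submission
  imports Defs "HOL-Real_Asymp.Real_Asymp"
begin

text \<open>
  Write \<open>\<gamma> = gam z1\<close>, \<open>w = W z2\<close> and \<open>p = \<alpha> / (\<alpha> - 1)\<close>. The function \<open>G0\<close> has the sign of
  \<open>\<gamma> - \<gamma>\<^sub>0\<close>, and for \<open>\<gamma> > \<gamma>\<^sub>0\<close> the equation that defines it can be solved for \<open>w\<close>:
  \<open>w = G0 powr p * a \<gamma>\<close> (\<open>W_eq_G0_powr\<close>). Since \<open>p > 0\<close>, for \<open>x \<ge> 0\<close> the event \<open>G0 \<le> x\<close> is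
  the event that \<open>\<gamma> \<le> \<gamma>\<^sub>0\<close> or \<open>w \<le> x powr p * a \<gamma>\<close> (\<open>G0_le_iff\<close>).

  For fixed \<open>z1\<close> this is a condition on \<open>z2\<close> of the form \<open>W z2 \<le> t\<close>, that is
  \<open>Phi z2 \<le> 1 - exp (- t)\<close>, which has probability \<open>1 - exp (- t)\<close>. The integral of \<open>z2\<close> over it is
  \<open>- phi_quantile (1 - exp (- t))\<close>, because \<open>- \<phi>\<close> is an antiderivative of \<open>z \<phi>(z)\<close>.
  Integrating these slices over \<open>z1\<close> by Fubini's theorem gives both coefficients as integrals
  over \<open>z1\<close>. As \<open>gam\<close> maps the standard normal law to the uniform law on an interval of length
  \<open>\<pi>\<close> (\<open>gam_uniform\<close>), and \<open>z1\<close> is the normal quantile at \<open>(\<gamma> + \<pi> / 2) / \<pi>\<close>, they become the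
  integrals over \<open>\<gamma>\<close> of the statement.

  Negative \<open>x\<close> reduce to positive ones by the symmetry \<open>z1 \<mapsto> - z1\<close> of the normal law, which
  turns \<open>G0\<close> for \<open>\<beta>\<close> into \<open>- G0\<close> for \<open>- \<beta>\<close> (\<open>G0_uminus\<close>). The event \<open>G0 \<le> x\<close> then becomes
  \<open>G0 \<ge> - x\<close>, which up to the null event \<open>G0 = - x\<close> is the complement of \<open>G0 \<le> - x\<close>. Passing
  to the complementary event changes the sign of a Hermite coefficient of positive degree; for
  the coefficient \<open>J\<^sub>1\<^sub>0\<close> the sign changes once more because of the factor \<open>z1\<close>.

  The rank is one because for every \<open>x\<close> one of the two coefficients is nonzero. For \<open>x > 0\<close>
  the integrand in \<open>J\<^sub>0\<^sub>1\<close> is strictly positive, and the reflection settles \<open>x < 0\<close>. For \<open>x = 0\<close>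
  the coefficient \<open>J\<^sub>0\<^sub>1\<close> vanishes, but \<open>J\<^sub>1\<^sub>0 = - \<phi>(q)\<close> with \<open>q\<close> the point where \<open>gam q = \<gamma>\<^sub>0\<close>.
\<close>

section \<open>The standard normal law\<close>

abbreviation (input) N :: "real measure" where
  "N \<equiv> std_normal_distribution"

interpretation N: real_distribution N
  by (rule real_dist_normal_dist)

interpretation NN: pair_prob_space N N ..

lemma normal_singleton_null: "{x} \<in> null_sets N"
  by (auto simp: null_sets_def emeasure_density intro!: nn_integral_null_set)

lemma AE_normal_neq: "AE z in N. z \<noteq> c"
  by (rule AE_I'[OF normal_singleton_null[of c]]) auto

lemma integral_normal_uminus:
  fixes f :: "real \<Rightarrow> real"
  assumes [measurable]: "f \<in> borel_measurable borel"
  shows "(\<integral>z. f (- z) \<partial>N) = (\<integral>z. f z \<partial>N)"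
proof -
  have "distributed N lborel (\<lambda>z. z) std_normal_density"
    by (auto simp: distributed_def distr_id2 cong: distr_cong)
  from prob_space.normal_density_affine[OF N.prob_space_axioms this, of "-1" 0]
  have "distributed N lborel uminus std_normal_density"
    by simp
  then have "distr N lborel uminus = N"
    by (simp add: distributed_def)
  then have "(\<integral>z. f z \<partial>N) = (\<integral>z. f z \<partial>distr N lborel uminus)"
    by simp
  also have "\<dots> = (\<integral>z. f (- z) \<partial>N)"
    by (subst integral_distr) auto
  finally show ?thesis ..
qed

lemma Phi_uminus: "Phi (- z) = 1 - Phi z"
proof -
  have "Phi (- z) = (\<integral>u. indicator {..- z} u \<partial>N)"
    by (simp add: cdf_def)
  also have "\<dots> = (\<integral>u. indicator {..- z} (- u) \<partial>N)"
    by (rule integral_normal_uminus[symmetric]) simp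
  also have "\<dots> = (\<integral>u. indicator {z..} u \<partial>N)"
    by (rule arg_cong[where f = "integral\<^sup>L N"]) (auto simp: indicator_def)
  also have "\<dots> = measure N {z..}"
    by simp
  also have "\<dots> = measure N {z<..}"
    by (rule N.finite_measure_eq_AE) (use AE_normal_neq[of z] in auto)
  also have "\<dots> = 1 - Phi z"
    using N.prob_compl[of "{..z}"] by (simp add: cdf_def Compl_eq_Diff_UNIV[symmetric])
  finally show ?thesis .
qed

lemma Phi_less_iff: "Phi a < Phi b \<longleftrightarrow> a < b"
  by (rule strict_mono_less[OF Phi_strict_mono])

lemma Phi_le_iff: "Phi a \<le> Phi b \<longleftrightarrow> a \<le> b"
  by (rule strict_mono_less_eq[OF Phi_strict_mono])

lemma Phi_eq_iff: "Phi a = Phi b \<longleftrightarrow> a = b"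
  by (rule strict_mono_eq[OF Phi_strict_mono])

lemma Phi_bounds: "0 < Phi z" "Phi z < 1"
  using Phi_range by (metis greaterThanLessThan_iff rangeI)+

lemma Phi_inv: "0 < p \<Longrightarrow> p < 1 \<Longrightarrow> Phi (inv Phi p) = p"
  using Phi_range by (intro f_inv_into_f) auto

lemma inv_Phi: "inv Phi (Phi z) = z"
  by (intro inv_f_f strict_mono_imp_inj_on Phi_strict_mono)

lemma Phi_measurable [measurable]: "Phi \<in> borel_measurable borel"
  by (rule borel_measurable_mono) (simp add: strict_mono_mono Phi_strict_mono)

text \<open>
  The function \<open>inv Phi\<close> is arbitrary outside the open unit interval, so it is cut off there to
  obtain a function that is measurable on the whole line.
\<close>

lemma quantile_measurable [measurable]:
  "(\<lambda>p. inv Phi p * indicator {0<..<1} p) \<in> borel_measurable borel"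
proof -
  have "mono_on {0<..<1} (inv Phi)"
    by (intro mono_onI) (metis Phi_inv Phi_le_iff greaterThanLessThan_iff)
  from borel_measurable_mono_on_fnc[OF this] show ?thesis
    by (subst (asm) borel_measurable_restrict_space_iff) (auto simp: mult.commute)
qed

lemma phi_quantile_measurable [measurable]: "phi_quantile \<in> borel_measurable borel"
proof -
  have "phi_quantile = (\<lambda>p. if 0 < p \<and> p < 1
      then std_normal_density (inv Phi p * indicator {0<..<1} p) else 0)"
    by (auto simp: phi_quantile_def fun_eq_iff)
  also have "\<dots> \<in> borel_measurable borel"
    by measurable
  finally show ?thesis .
qed

lemma std_normal_density_le_1: "std_normal_density u \<le> 1"
proof -
  have "1 \<le> sqrt (2 * pi)"
    using pi_gt3 by simp
  moreover have "exp (- u\<^sup>2 / 2) \<le> 1" by simp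
  ultimately have "exp (- u\<^sup>2 / 2) \<le> sqrt (2 * pi)"
    by linarith
  then show ?thesis
    by (simp add: std_normal_density_def divide_simps)
qed

lemma phi_quantile_nonneg: "0 \<le> phi_quantile p"
  by (simp add: phi_quantile_def)

lemma phi_quantile_le_1: "phi_quantile p \<le> 1"
  by (simp add: phi_quantile_def std_normal_density_le_1)

lemma phi_quantile_pos: "0 < p \<Longrightarrow> p < 1 \<Longrightarrow> 0 < phi_quantile p"
  by (simp add: phi_quantile_def normal_density_pos)

lemma integrable_normal_id: "integrable N (\<lambda>z. z)"
  using integrable_std_normal_distribution_moment[of 1] by simp

lemma integral_normal_id: "(\<integral>z. z \<partial>N) = 0"
  using integral_std_normal_distribution_moment_odd[of 1] by simp

lemma integrable_normal_indicator_times_id: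
  "A \<in> sets borel \<Longrightarrow> integrable N (\<lambda>z. indicator A z * z)"
  by (rule Bochner_Integration.integrable_bound[OF integrable_normal_id])
    (auto simp: indicator_def)

lemma std_normal_density_tendsto_0: "(std_normal_density \<longlongrightarrow> 0) at_bot"
proof -
  have "((\<lambda>u::real. 1 / sqrt (2 * pi) * exp (- u\<^sup>2 / 2)) \<longlongrightarrow> 0) at_bot"
    by real_asymp
  then show ?thesis
    by (simp add: std_normal_density_def[abs_def])
qed

text \<open>
  The fundamental theorem of calculus on \<open>(-\<infinity>, q)\<close>: the function \<open>- \<phi>\<close> is an antiderivative of
  \<open>z \<phi>(z)\<close> and vanishes at \<open>-\<infinity>\<close>.
\<close>

lemma normal_truncated_mean:
  "(\<integral>z. indicator {..q} z * z \<partial>N) = - std_normal_density q"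
proof -
  have int: "integrable lborel (\<lambda>z. indicator {..<q} z * (z * std_normal_density z))"
  proof -
    have "integrable N (\<lambda>z. indicator {..<q} z * z)"
      by (rule integrable_normal_indicator_times_id) auto
    then show ?thesis
      by (subst (asm) integrable_density) (auto simp: mult_ac)
  qed
  have eint: "einterval (-\<infinity>) (ereal q) = {..<q}"
    by (auto simp: einterval_def)
  have "(LBINT z=-\<infinity>..ereal q. z * std_normal_density z) = - std_normal_density q - 0"
  proof (rule interval_integral_FTC_integrable[where F = "\<lambda>z. - std_normal_density z"])
    show "((\<lambda>z. - std_normal_density z) has_vector_derivative z * std_normal_density z) (at z)" for z
      using DERIV_minus[OF DERIV_std_normal_density[of z]]
      by (simp add: has_real_derivative_iff_has_vector_derivative)
    show "isCont (\<lambda>z. z * std_normal_density z) z" for z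
      by (intro continuous_intros DERIV_isCont[OF DERIV_std_normal_density])
    show "set_integrable lborel (einterval (-\<infinity>) (ereal q)) (\<lambda>z. z * std_normal_density z)"
      using int by (simp add: set_integrable_def eint)
    show "(((\<lambda>z. - std_normal_density z) \<circ> real_of_ereal) \<longlongrightarrow> 0) (at_right (-\<infinity>))"
      using tendsto_minus[OF std_normal_density_tendsto_0]
      by (simp add: o_def at_right_MInf filterlim_filtermap)
    have "((\<lambda>z. - std_normal_density z) \<longlongrightarrow> - std_normal_density q) (at_left q)"
      using DERIV_isCont[OF DERIV_std_normal_density[of q]]
      by (intro tendsto_minus) (auto simp: isCont_def filterlim_at_split)
    then show "(((\<lambda>z. - std_normal_density z) \<circ> real_of_ereal) \<longlongrightarrow> - std_normal_density q)
        (at_left (ereal q))"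
      by (simp add: o_def at_left_ereal filterlim_filtermap)
  qed simp
  then have *: "(\<integral>z. indicator {..<q} z * (z * std_normal_density z) \<partial>lborel) = - std_normal_density q"
    by (simp add: interval_lebesgue_integral_def set_lebesgue_integral_def eint)
  have "(\<integral>z. indicator {..q} z * z \<partial>N) = (\<integral>z. indicator {..<q} z * z \<partial>N)"
    by (rule integral_cong_AE) (use AE_normal_neq[of q] in \<open>auto simp: indicator_def\<close>)
  also have "\<dots> = - std_normal_density q"
    by (subst integral_density) (use * in \<open>auto simp: mult_ac\<close>)
  finally show ?thesis .
qed

section \<open>The uniform variable \<open>gam\<close> and the exponential variable \<open>W\<close>\<close>

lemma W_pos: "0 < W z"
  using Phi_bounds[of z] by (simp add: W_def)

lemma W_eq_iff: "W a = W b \<longleftrightarrow> a = b"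
  using Phi_bounds[of a] Phi_bounds[of b] by (simp add: W_def Phi_eq_iff)

lemma W_le_iff_Phi: "W z \<le> t \<longleftrightarrow> Phi z \<le> 1 - exp (- t)"
proof -
  have "W z \<le> t \<longleftrightarrow> ln (exp (- t)) \<le> ln (1 - Phi z)"
    by (auto simp: W_def)
  also have "\<dots> \<longleftrightarrow> exp (- t) \<le> 1 - Phi z"
    using Phi_bounds[of z] by (subst ln_le_cancel_iff) auto
  finally show ?thesis by auto
qed

text \<open>
  The case \<open>t = 0\<close> occurs for \<open>x = 0\<close> and has to be separate: the level \<open>1 - exp (- t)\<close> is then
  \<open>0\<close>, at which \<open>inv Phi\<close> has no meaning.
\<close>

lemma W_sublevel:
  "0 < t \<Longrightarrow> {z. W z \<le> t} = {.. inv Phi (1 - exp (- t))}"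
  "t \<le> 0 \<Longrightarrow> {z. W z \<le> t} = {}"
proof -
  assume "0 < t"
  then have "Phi (inv Phi (1 - exp (- t))) = 1 - exp (- t)"
    by (intro Phi_inv) auto
  then have "W z \<le> t \<longleftrightarrow> z \<le> inv Phi (1 - exp (- t))" for z
    using W_le_iff_Phi[of z t] Phi_le_iff[of z "inv Phi (1 - exp (- t))"] by simp
  then show "{z. W z \<le> t} = {.. inv Phi (1 - exp (- t))}"
    by auto
next
  assume "t \<le> 0"
  then have "\<not> W z \<le> t" for z
    using W_pos[of z] by linarith
  then show "{z. W z \<le> t} = {}"
    by auto
qed

lemma exponential_probability:
  assumes "0 \<le> t"
  shows "(\<integral>z. indicator {z. W z \<le> t} z \<partial>N) = 1 - exp (- t)"
proof (cases "t = 0")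
  case False
  then show ?thesis
    using assms Phi_inv[of "1 - exp (- t)"] by (simp add: W_sublevel cdf_def)
qed (simp add: W_sublevel)

text \<open>
  The convention that \<open>phi_quantile\<close> is zero at \<open>0\<close> makes the formula hold at \<open>t = 0\<close>.
\<close>

lemma exponential_truncated_mean:
  assumes "0 \<le> t"
  shows "(\<integral>z. indicator {z. W z \<le> t} z * z \<partial>N) = - phi_quantile (1 - exp (- t))"
proof (cases "t = 0")
  case False
  then show ?thesis
    using assms by (simp add: W_sublevel normal_truncated_mean phi_quantile_def)
qed (simp add: W_sublevel phi_quantile_def)

lemma gam_bounds: "- (pi / 2) < gam z" "gam z < pi / 2"
  using Phi_bounds[of z] by (auto simp: gam_def)

lemma gam_less_iff: "gam a < gam b \<longleftrightarrow> a < b"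
  by (simp add: gam_def Phi_less_iff)

lemma gam_uminus: "gam (- z) = - gam z"
  by (simp add: gam_def Phi_uminus algebra_simps)

lemma gam_measurable [measurable]: "gam \<in> borel_measurable borel"
  unfolding gam_def[abs_def] by measurable

lemma quantile_gam: "inv Phi (1 / pi * (gam z + pi / 2)) = z"
  by (simp add: gam_def inv_Phi)

lemma gam_uniform:
  "distributed N lborel gam (\<lambda>\<gamma>. indicator {- (pi / 2)..pi / 2} \<gamma> / measure lborel {- (pi / 2)..pi / 2})"
proof (rule N.uniform_distrI_borel_atLeastAtMost)
  fix t assume t: "- (pi / 2) \<le> t" "t \<le> pi / 2"
  define p where "p = (t + pi / 2) / pi"
  have gam_le: "gam z \<le> t \<longleftrightarrow> Phi z \<le> p" for z
    by (simp add: gam_def p_def field_simps)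
  have "measure N {z. gam z \<le> t} = p"
  proof -
    consider "p = 0" | "p = 1" | "0 < p" "p < 1"
      using t by (force simp: p_def field_simps)
    then show ?thesis
    proof cases
      case 1
      then show ?thesis using Phi_bounds by (simp add: gam_le not_le[symmetric])
    next
      case 2
      then show ?thesis using Phi_bounds N.prob_space by (simp add: gam_le less_imp_le)
    next
      case 3
      then have "{z. gam z \<le> t} = {..inv Phi p}"
        using Phi_le_iff[of _ "inv Phi p"] by (auto simp: gam_le Phi_inv)
      moreover have "measure N {..inv Phi p} = p"
        using Phi_inv[OF 3] by (simp only: cdf_def)
      ultimately show ?thesis by simp
    qed
  qed
  then show "\<P>(z in N. gam z \<le> t) = (t - - (pi / 2)) / (pi / 2 - - (pi / 2))"
    by (simp add: p_def)
qed auto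

text \<open>
  The substitution \<open>\<gamma> = gam z\<close>, with \<open>d\<gamma> = \<pi> \<phi>(z) dz\<close>, carried out as an image of measures.
  Measurability is required of \<open>f\<close> cut off to the interval only, because \<open>inv Phi\<close> will occur
  in \<open>f\<close>.
\<close>

lemma gam_substitution:
  fixes f :: "real \<Rightarrow> real"
  assumes f: "(\<lambda>\<gamma>. indicator {c<..<pi / 2} \<gamma> * f \<gamma>) \<in> borel_measurable borel"
    and c: "- (pi / 2) \<le> c"
    and int: "integrable N (\<lambda>z. indicator {c<..} (gam z) * f (gam z))"
  shows "set_integrable lborel {c<..<pi / 2} f"
    and "(\<integral>z. indicator {c<..} (gam z) * f (gam z) \<partial>N) = 1 / pi * (LBINT \<gamma>:{c<..<pi / 2}. f \<gamma>)"
proof -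
  let ?g = "\<lambda>\<gamma>. indicator {c<..<pi / 2} \<gamma> * f \<gamma>"
  have m: "measure lborel {- (pi / 2)..pi / 2} = pi"
    by simp
  have g_gam: "?g (gam z) = indicator {c<..} (gam z) * f (gam z)" for z
    using gam_bounds[of z] by (simp add: indicator_def)
  have dens: "indicator {- (pi / 2)..pi / 2} \<gamma> / measure lborel {- (pi / 2)..pi / 2} * ?g \<gamma> = 1 / pi * ?g \<gamma>" for \<gamma>
    using c unfolding m by (auto simp: indicator_def)
  have "integrable lborel (\<lambda>\<gamma>. 1 / pi * ?g \<gamma>)"
    using distributed_integrable[OF gam_uniform, of ?g] f int unfolding dens g_gam by simp
  from integrable_mult_right[OF this, of pi]
  show "set_integrable lborel {c<..<pi / 2} f"
    by (simp add: set_integrable_def)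
  have "(\<integral>\<gamma>. 1 / pi * ?g \<gamma> \<partial>lborel) = (\<integral>z. ?g (gam z) \<partial>N)"
    using distributed_integral[OF gam_uniform, of ?g] f unfolding dens by simp
  then show "(\<integral>z. indicator {c<..} (gam z) * f (gam z) \<partial>N) = 1 / pi * (LBINT \<gamma>:{c<..<pi / 2}. f \<gamma>)"
    unfolding g_gam by (simp add: set_lebesgue_integral_def)
qed

section \<open>The representation \<open>G0\<close> of a stable variable\<close>

lemma gam0_uminus: "gam0 \<alpha> (- \<beta>) = - gam0 \<alpha> \<beta>"
  by (simp add: gam0_def)

lemma G0_uminus: "G0 \<alpha> \<beta> (- z1) z2 = - G0 \<alpha> (- \<beta>) z1 z2"
proof -
  have 1: "\<alpha> * (gam (- z1) - gam0 \<alpha> \<beta>) = - (\<alpha> * (gam z1 - gam0 \<alpha> (- \<beta>)))"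
    by (simp add: gam_uminus gam0_uminus algebra_simps)
  have 2: "gam (- z1) - - (\<alpha> * (gam z1 - gam0 \<alpha> (- \<beta>))) = - (gam z1 - \<alpha> * (gam z1 - gam0 \<alpha> (- \<beta>)))"
    by (simp add: gam_uminus)
  show ?thesis
    unfolding G0_def 1 2 unfolding gam_uminus sin_minus cos_minus by simp
qed

lemma W_measurable [measurable]: "W \<in> borel_measurable borel"
  unfolding W_def[abs_def] by measurable

lemma G0_measurable [measurable]:
  "(\<lambda>(z1, z2). G0 \<alpha> \<beta> z1 z2) \<in> borel_measurable (borel \<Otimes>\<^sub>M borel)"
  unfolding G0_def by measurable

lemma a_fun_measurable [measurable]: "a_fun \<alpha> \<beta> \<in> borel_measurable borel"
  unfolding a_fun_def[abs_def] by measurable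

context
  fixes \<alpha> \<beta> :: real
  assumes \<alpha>: "1 < \<alpha>" "\<alpha> < 2" and \<beta>: "- 1 \<le> \<beta>" "\<beta> \<le> 1"
begin

text \<open>
  Here \<open>K \<alpha> = \<alpha> - 2\<close>, so \<open>\<alpha> * gam0 \<alpha> \<beta>\<close> equals \<open>\<beta> * \<pi> * (2 - \<alpha>) / 2\<close>. This bound, attained for
  \<open>\<beta> = 1\<close> and \<open>\<beta> = -1\<close>, is exactly what keeps the arguments of the sine and cosine factors in \<open>G0\<close>
  within the ranges where their signs are constant.
\<close>

lemma alpha_gam0_bounds: "\<bar>\<alpha> * gam0 \<alpha> \<beta>\<bar> \<le> pi * (2 - \<alpha>) / 2"
proof -
  have "\<alpha> * gam0 \<alpha> \<beta> = \<beta> * (pi * (2 - \<alpha>) / 2)"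
    using \<alpha> by (simp add: gam0_def K_def field_simps)
  moreover have "\<bar>\<beta>\<bar> * (pi * (2 - \<alpha>) / 2) \<le> 1 * (pi * (2 - \<alpha>) / 2)"
    using \<alpha> \<beta> by (intro mult_right_mono) auto
  moreover have "\<bar>\<beta> * (pi * (2 - \<alpha>) / 2)\<bar> = \<bar>\<beta>\<bar> * (pi * (2 - \<alpha>) / 2)"
    using \<alpha> by (simp add: abs_mult)
  ultimately show ?thesis
    by linarith
qed

lemma gam0_bounds: "- (pi / 2) < gam0 \<alpha> \<beta>" "gam0 \<alpha> \<beta> < pi / 2"
proof -
  have "pi * (2 - \<alpha>) / 2 < \<alpha> * (pi / 2)"
    using \<alpha> by (simp add: field_simps)
  with alpha_gam0_bounds have "\<alpha> * gam0 \<alpha> \<beta> < \<alpha> * (pi / 2)" "\<alpha> * (- (pi / 2)) < \<alpha> * gam0 \<alpha> \<beta>"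
    by linarith+
  then show "- (pi / 2) < gam0 \<alpha> \<beta>" "gam0 \<alpha> \<beta> < pi / 2"
    using \<alpha> by (auto simp only: mult_less_cancel_left_pos)
qed

lemma sin_pos:
  assumes "gam0 \<alpha> \<beta> < \<gamma>" "\<gamma> < pi / 2"
  shows "0 < sin (\<alpha> * (\<gamma> - gam0 \<alpha> \<beta>))"
proof (rule sin_gt_zero)
  have "\<alpha> * \<gamma> < \<alpha> * (pi / 2)"
    using assms \<alpha> by (intro mult_strict_left_mono) auto
  then show "\<alpha> * (\<gamma> - gam0 \<alpha> \<beta>) < pi"
    using alpha_gam0_bounds by (simp add: abs_le_iff algebra_simps)
qed (use assms \<alpha> in auto)

lemma sin_nonpos:
  assumes "- (pi / 2) < \<gamma>" "\<gamma> \<le> gam0 \<alpha> \<beta>"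
  shows "sin (\<alpha> * (\<gamma> - gam0 \<alpha> \<beta>)) \<le> 0"
proof -
  have "\<alpha> * (- (pi / 2)) < \<alpha> * \<gamma>"
    using assms \<alpha> by (intro mult_strict_left_mono) auto
  then have "- (\<alpha> * (\<gamma> - gam0 \<alpha> \<beta>)) \<le> pi"
    using alpha_gam0_bounds by (simp add: abs_le_iff algebra_simps)
  moreover have "0 \<le> - (\<alpha> * (\<gamma> - gam0 \<alpha> \<beta>))"
    using assms \<alpha> by (simp add: mult_le_0_iff)
  ultimately have "0 \<le> sin (- (\<alpha> * (\<gamma> - gam0 \<alpha> \<beta>)))"
    by (intro sin_ge_zero)
  then show ?thesis by simp
qed

lemma cos_pos:
  assumes "- (pi / 2) < \<gamma>" "\<gamma> < pi / 2"
  shows "0 < cos (\<gamma> - \<alpha> * (\<gamma> - gam0 \<alpha> \<beta>))"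
proof (rule cos_gt_zero_pi)
  have "(\<alpha> - 1) * \<gamma> < (\<alpha> - 1) * (pi / 2)" "(\<alpha> - 1) * (- (pi / 2)) < (\<alpha> - 1) * \<gamma>"
    by (rule mult_strict_left_mono; use assms \<alpha> in simp)+
  moreover have "(\<alpha> - 1) * (pi / 2) + pi * (2 - \<alpha>) / 2 = pi / 2"
    by (simp add: field_simps)
  moreover have "\<gamma> - \<alpha> * (\<gamma> - gam0 \<alpha> \<beta>) = \<alpha> * gam0 \<alpha> \<beta> - (\<alpha> - 1) * \<gamma>"
    by (simp add: algebra_simps)
  ultimately show "- (pi / 2) < \<gamma> - \<alpha> * (\<gamma> - gam0 \<alpha> \<beta>)" "\<gamma> - \<alpha> * (\<gamma> - gam0 \<alpha> \<beta>) < pi / 2"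
    using alpha_gam0_bounds by linarith+
qed

lemma a_fun_pos:
  assumes "gam0 \<alpha> \<beta> < \<gamma>" "\<gamma> < pi / 2"
  shows "0 < a_fun \<alpha> \<beta> \<gamma>"
  using sin_pos[OF assms] cos_pos[of \<gamma>] cos_gt_zero_pi[of \<gamma>] assms gam0_bounds
  by (simp add: a_fun_def)

lemma G0_nonpos: "gam z1 \<le> gam0 \<alpha> \<beta> \<Longrightarrow> G0 \<alpha> \<beta> z1 z2 \<le> 0"
  using sin_nonpos[OF gam_bounds(1), of z1]
  by (auto simp: G0_def intro!: mult_nonpos_nonneg divide_nonpos_nonneg)

lemma G0_pos:
  assumes "gam0 \<alpha> \<beta> < gam z1"
  shows "0 < G0 \<alpha> \<beta> z1 z2"
  using sin_pos[OF assms gam_bounds(2)] cos_pos[OF gam_bounds, of z1]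
    cos_gt_zero_pi[OF gam_bounds, of z1] W_pos[of z2]
  by (auto simp: G0_def intro!: mult_pos_pos divide_pos_pos)

text \<open>
  The identity behind the whole computation: \<open>a_fun\<close> is the factor that remains when the
  definition of \<open>G0\<close> is solved for \<open>W z2\<close>. After taking logarithms it is linear in the logarithms
  of the sine, the two cosines and \<open>W z2\<close>, and \<open>\<alpha> / (\<alpha> - 1) - 1 / (\<alpha> - 1) = 1\<close> makes the powers of
  \<open>cos (gam z1)\<close> cancel.
\<close>

lemma W_eq_G0_powr:
  assumes "gam0 \<alpha> \<beta> < gam z1"
  shows "W z2 = G0 \<alpha> \<beta> z1 z2 powr (\<alpha> / (\<alpha> - 1)) * a_fun \<alpha> \<beta> (gam z1)"
proof -
  let ?s = "sin (\<alpha> * (gam z1 - gam0 \<alpha> \<beta>))" and ?c = "cos (gam z1)"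
    and ?C = "cos (gam z1 - \<alpha> * (gam z1 - gam0 \<alpha> \<beta>))"
  note pos = sin_pos[OF assms gam_bounds(2)] cos_pos[OF gam_bounds, of z1]
    cos_gt_zero_pi[OF gam_bounds, of z1] W_pos[of z2] G0_pos[OF assms, of z2]
    a_fun_pos[OF assms gam_bounds(2)]
  have "ln (G0 \<alpha> \<beta> z1 z2) = ln ?s - 1 / \<alpha> * ln ?c + (1 - \<alpha>) / \<alpha> * (ln ?C - ln (W z2))"
    using pos by (simp add: G0_def ln_mult ln_div ln_powr)
  then have "\<alpha> / (\<alpha> - 1) * ln (G0 \<alpha> \<beta> z1 z2) =
      \<alpha> / (\<alpha> - 1) * ln ?s - 1 / (\<alpha> - 1) * ln ?c - (ln ?C - ln (W z2))"
    using \<alpha> by (simp add: divide_simps) (simp add: algebra_simps)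
  moreover have "ln (a_fun \<alpha> \<beta> (gam z1)) = \<alpha> / (1 - \<alpha>) * (ln ?s - ln ?c) + (ln ?C - ln ?c)"
    using pos by (simp add: a_fun_def ln_mult ln_div ln_powr)
  moreover have "\<alpha> / (1 - \<alpha>) * (ln ?s - ln ?c) =
      - (\<alpha> / (\<alpha> - 1) * ln ?s) + 1 / (\<alpha> - 1) * ln ?c + ln ?c"
    using \<alpha> by (simp add: divide_simps) (simp add: algebra_simps)
  ultimately have "\<alpha> / (\<alpha> - 1) * ln (G0 \<alpha> \<beta> z1 z2) + ln (a_fun \<alpha> \<beta> (gam z1)) = ln (W z2)"
    by linarith
  then have "ln (W z2) = ln (G0 \<alpha> \<beta> z1 z2 powr (\<alpha> / (\<alpha> - 1)) * a_fun \<alpha> \<beta> (gam z1))"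
    using pos by (simp add: ln_mult ln_powr)
  then show ?thesis
    using pos by (subst (asm) ln_inj_iff) auto
qed

lemma G0_le_iff:
  assumes "0 \<le> x"
  shows "G0 \<alpha> \<beta> z1 z2 \<le> x \<longleftrightarrow>
    gam z1 \<le> gam0 \<alpha> \<beta> \<or> W z2 \<le> x powr (\<alpha> / (\<alpha> - 1)) * a_fun \<alpha> \<beta> (gam z1)"
proof (cases "gam z1 \<le> gam0 \<alpha> \<beta>")
  case True
  then show ?thesis using G0_nonpos[of z1 z2] assms by simp
next
  case False
  then have g: "gam0 \<alpha> \<beta> < gam z1" by simp
  let ?p = "\<alpha> / (\<alpha> - 1)"
  have "G0 \<alpha> \<beta> z1 z2 \<le> x \<longleftrightarrow> G0 \<alpha> \<beta> z1 z2 powr ?p \<le> x powr ?p"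
    using G0_pos[OF g, of z2] assms \<alpha> powr_less_mono2[of ?p x "G0 \<alpha> \<beta> z1 z2"]
      powr_mono2[of ?p "G0 \<alpha> \<beta> z1 z2" x]
    by fastforce
  also have "\<dots> \<longleftrightarrow> W z2 \<le> x powr ?p * a_fun \<alpha> \<beta> (gam z1)"
    unfolding W_eq_G0_powr[OF g, of z2]
    using a_fun_pos[OF g gam_bounds(2)] by simp
  finally show ?thesis using False by simp
qed

text \<open>
  For fixed \<open>z1\<close> the value \<open>y > 0\<close> is taken for at most one \<open>z2\<close>, since it determines \<open>W z2\<close>. For
  \<open>y = 0\<close> this would fail: \<open>G0\<close> vanishes on the whole slice when \<open>gam z1 = gam0 \<alpha> \<beta>\<close>.
\<close>

lemma AE_G0_neq:
  assumes "0 < y"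
  shows "AE z2 in N. G0 \<alpha> \<beta> z1 z2 \<noteq> y"
proof (cases "\<exists>c. G0 \<alpha> \<beta> z1 c = y")
  case True
  then obtain c where c: "G0 \<alpha> \<beta> z1 c = y" ..
  then have g: "gam0 \<alpha> \<beta> < gam z1"
    using G0_nonpos[of z1 c] assms by linarith
  have "z2 = c" if "G0 \<alpha> \<beta> z1 z2 = y" for z2
    using W_eq_G0_powr[OF g, of z2] W_eq_G0_powr[OF g, of c] that c W_eq_iff[of z2 c] by simp
  then show ?thesis
    using AE_normal_neq[of c] by (auto elim!: eventually_mono)
qed simp

text \<open>
  The conditional expectations given the first normal variable. If \<open>gam z1 \<le> gam0 \<alpha> \<beta>\<close>, the
  event \<open>G0 \<le> x\<close> is certain on the slice; otherwise it is an event \<open>W z2 \<le> t\<close>.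
\<close>

lemma slice_probability:
  assumes "0 \<le> x"
  shows "(\<integral>z2. indicator {..x} (G0 \<alpha> \<beta> z1 z2) \<partial>N) =
    1 - indicator {gam0 \<alpha> \<beta><..} (gam z1) * exp (- (x powr (\<alpha> / (\<alpha> - 1))) * a_fun \<alpha> \<beta> (gam z1))"
proof (cases "gam z1 \<le> gam0 \<alpha> \<beta>")
  case True
  then show ?thesis
    using assms N.prob_space by (simp add: indicator_def G0_le_iff)
next
  case False
  let ?t = "x powr (\<alpha> / (\<alpha> - 1)) * a_fun \<alpha> \<beta> (gam z1)"
  have "0 \<le> ?t"
    using False a_fun_pos[of "gam z1"] gam_bounds[of z1] by simp
  moreover have "indicator {..x} (G0 \<alpha> \<beta> z1 z2) = (indicator {z. W z \<le> ?t} z2 :: real)" for z2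
    using False assms by (simp add: indicator_def G0_le_iff)
  ultimately show ?thesis
    using False exponential_probability[of ?t] by simp
qed

lemma slice_mean:
  assumes "0 \<le> x"
  shows "(\<integral>z2. indicator {..x} (G0 \<alpha> \<beta> z1 z2) * z2 \<partial>N) =
    - (indicator {gam0 \<alpha> \<beta><..} (gam z1)
      * phi_quantile (1 - exp (- (x powr (\<alpha> / (\<alpha> - 1))) * a_fun \<alpha> \<beta> (gam z1))))"
proof (cases "gam z1 \<le> gam0 \<alpha> \<beta>")
  case True
  then show ?thesis
    using assms integral_normal_id by (simp add: indicator_def G0_le_iff)
next
  case False
  let ?t = "x powr (\<alpha> / (\<alpha> - 1)) * a_fun \<alpha> \<beta> (gam z1)"
  have "0 \<le> ?t"
    using False a_fun_pos[of "gam z1"] gam_bounds[of z1] by simp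
  moreover have "indicator {..x} (G0 \<alpha> \<beta> z1 z2) = (indicator {z. W z \<le> ?t} z2 :: real)" for z2
    using False assms by (simp add: indicator_def G0_le_iff)
  ultimately show ?thesis
    using False exponential_truncated_mean[of ?t] by simp
qed

end

text \<open>
  Flipping \<open>z1\<close> turns the event \<open>G0 \<le> x\<close> into \<open>G0 \<ge> - x\<close> for the opposite asymmetry; ties are
  negligible, so this is the complement of \<open>G0 \<le> - x\<close>.
\<close>

lemma AE_indicator_G0_reflect:
  assumes "1 < \<alpha>" "\<alpha> < 2" "- 1 \<le> \<beta>" "\<beta> \<le> 1" and "x < 0"
  shows "AE z2 in N. indicator {..x} (G0 \<alpha> \<beta> (- z1) z2) =
    1 - (indicator {..- x} (G0 \<alpha> (- \<beta>) z1 z2) :: real)"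
proof -
  have "AE z2 in N. G0 \<alpha> (- \<beta>) z1 z2 \<noteq> - x"
    using assms by (intro AE_G0_neq) auto
  then show ?thesis
    by (rule eventually_mono) (auto simp: G0_uminus indicator_def)
qed

section \<open>The Hermite coefficients of total degree one\<close>

text \<open>
  Integrability on the product, needed for Fubini's theorem: the indicator times a coordinate is
  dominated by that coordinate, which has a first moment.
\<close>

lemma integrable_indicator_G0:
  "integrable (N \<Otimes>\<^sub>M N) (\<lambda>(z1, z2). indicator {..x} (G0 \<alpha> \<beta> z1 z2) * z1)"
  "integrable (N \<Otimes>\<^sub>M N) (\<lambda>(z1, z2). indicator {..x} (G0 \<alpha> \<beta> z1 z2) * z2)"
proof -
  have "integrable (N \<Otimes>\<^sub>M N) (\<lambda>(z1, z2). z1)"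
    by (rule NN.Fubini_integrable) (use integrable_normal_id N.prob_space in auto)
  then show "integrable (N \<Otimes>\<^sub>M N) (\<lambda>(z1, z2). indicator {..x} (G0 \<alpha> \<beta> z1 z2) * z1)"
    by (rule Bochner_Integration.integrable_bound) (auto simp: indicator_def)
  have "integrable (N \<Otimes>\<^sub>M N) (\<lambda>(z1, z2). z2)"
    by (rule NN.Fubini_integrable) (use integrable_normal_id in auto)
  then show "integrable (N \<Otimes>\<^sub>M N) (\<lambda>(z1, z2). indicator {..x} (G0 \<alpha> \<beta> z1 z2) * z2)"
    by (rule Bochner_Integration.integrable_bound) (auto simp: indicator_def)
qed

context
  fixes M :: "'a measure" and Z1 Z2 :: "'a \<Rightarrow> real"
  assumes M: "prob_space M"
    and Z1: "distributed M lborel Z1 std_normal_density"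
    and Z2: "distributed M lborel Z2 std_normal_density"
    and indep: "prob_space.indep_var M borel Z1 borel Z2"
begin

lemma expectation_normal_pair:
  fixes f :: "real \<times> real \<Rightarrow> real"
  assumes f: "integrable (N \<Otimes>\<^sub>M N) f"
  shows "(\<integral>\<omega>. f (Z1 \<omega>, Z2 \<omega>) \<partial>M) = (\<integral>z1. (\<integral>z2. f (z1, z2) \<partial>N) \<partial>N)"
proof -
  interpret M: prob_space M by (rule M)
  have rv [measurable]: "Z1 \<in> borel_measurable M" "Z2 \<in> borel_measurable M"
    using distributed_measurable[OF Z1] distributed_measurable[OF Z2] by auto
  have "distr M borel Z1 = N" "distr M borel Z2 = N"
    using distributed_distr_eq_density[OF Z1] distributed_distr_eq_density[OF Z2]
    by (simp_all cong: distr_cong)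
  then have joint: "distr M (borel \<Otimes>\<^sub>M borel) (\<lambda>\<omega>. (Z1 \<omega>, Z2 \<omega>)) = N \<Otimes>\<^sub>M N"
    using indep by (simp add: M.indep_var_distribution_eq)
  have [measurable]: "f \<in> borel_measurable (borel \<Otimes>\<^sub>M borel)"
    using borel_measurable_integrable[OF f] by (simp cong: measurable_cong_sets)
  have "(\<integral>\<omega>. f (Z1 \<omega>, Z2 \<omega>) \<partial>M) = (\<integral>z. f z \<partial>(N \<Otimes>\<^sub>M N))"
    unfolding joint[symmetric] by (subst integral_distr) auto
  also have "\<dots> = (\<integral>z1. (\<integral>z2. f (z1, z2) \<partial>N) \<partial>N)"
    by (rule NN.integral_fst'[OF f, symmetric])
  finally show ?thesis .
qed

lemma hermite_coeff_1_0_iterated: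
  "hermite_coeff M Z1 Z2 \<alpha> 1 0 x \<beta> = (\<integral>z1. z1 * (\<integral>z2. indicator {..x} (G0 \<alpha> \<beta> z1 z2) \<partial>N) \<partial>N)"
  using expectation_normal_pair[OF integrable_indicator_G0(1)[of x \<alpha> \<beta>]]
  unfolding hermite_coeff_def hermite_0 hermite_1 by (simp add: mult.commute)

lemma hermite_coeff_0_1_iterated:
  "hermite_coeff M Z1 Z2 \<alpha> 0 1 x \<beta> = (\<integral>z1. (\<integral>z2. indicator {..x} (G0 \<alpha> \<beta> z1 z2) * z2 \<partial>N) \<partial>N)"
  using expectation_normal_pair[OF integrable_indicator_G0(2)[of x \<alpha> \<beta>]]
  unfolding hermite_coeff_def hermite_0 hermite_1 by simp

context
  fixes \<alpha> \<beta> :: real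
  assumes \<alpha>: "1 < \<alpha>" "\<alpha> < 2" and \<beta>: "- 1 \<le> \<beta>" "\<beta> \<le> 1"
begin

text \<open>
  The constant part of the slice probability drops out because \<open>z1\<close> has mean zero; only the
  exponential term, which lives on \<open>gam z1 > gam0 \<alpha> \<beta>\<close>, remains.
\<close>

lemma hermite_coeff_1_0_normal:
  assumes x: "0 \<le> x"
  shows "integrable N (\<lambda>z. indicator {gam0 \<alpha> \<beta><..} (gam z) *
      (exp (- (x powr (\<alpha> / (\<alpha> - 1))) * a_fun \<alpha> \<beta> (gam z)) * z))" (is "integrable N ?f")
    and "hermite_coeff M Z1 Z2 \<alpha> 1 0 x \<beta> = - (\<integral>z. indicator {gam0 \<alpha> \<beta><..} (gam z) *
      (exp (- (x powr (\<alpha> / (\<alpha> - 1))) * a_fun \<alpha> \<beta> (gam z)) * z) \<partial>N)"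
proof -
  have "norm (?f z) \<le> norm z" for z
    using a_fun_pos[OF \<alpha> \<beta> _ gam_bounds(2), of z]
    by (auto simp: indicator_def abs_mult intro!: mult_left_le_one_le)
  then show int: "integrable N ?f"
    by (intro Bochner_Integration.integrable_bound[OF integrable_normal_id]) auto
  have "hermite_coeff M Z1 Z2 \<alpha> 1 0 x \<beta> = (\<integral>z. z - ?f z \<partial>N)"
    unfolding hermite_coeff_1_0_iterated slice_probability[OF \<alpha> \<beta> x]
    by (simp add: algebra_simps)
  also have "\<dots> = - (\<integral>z. ?f z \<partial>N)"
    using integrable_normal_id int by (simp add: integral_normal_id)
  finally show "hermite_coeff M Z1 Z2 \<alpha> 1 0 x \<beta> = - (\<integral>z. ?f z \<partial>N)" .
qed

lemma hermite_coeff_0_1_normal: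
  assumes x: "0 \<le> x"
  shows "integrable N (\<lambda>z. indicator {gam0 \<alpha> \<beta><..} (gam z) *
      phi_quantile (1 - exp (- (x powr (\<alpha> / (\<alpha> - 1))) * a_fun \<alpha> \<beta> (gam z))))" (is "integrable N ?f")
    and "hermite_coeff M Z1 Z2 \<alpha> 0 1 x \<beta> = - (\<integral>z. indicator {gam0 \<alpha> \<beta><..} (gam z) *
      phi_quantile (1 - exp (- (x powr (\<alpha> / (\<alpha> - 1))) * a_fun \<alpha> \<beta> (gam z))) \<partial>N)"
proof -
  have "norm (?f z) \<le> 1" for z
    using phi_quantile_nonneg phi_quantile_le_1 by (auto simp: indicator_def)
  then show "integrable N ?f"
    by (intro N.integrable_const_bound[where B = 1]) auto
  show "hermite_coeff M Z1 Z2 \<alpha> 0 1 x \<beta> = - (\<integral>z. ?f z \<partial>N)"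
    unfolding hermite_coeff_0_1_iterated slice_mean[OF \<alpha> \<beta> x] by simp
qed

lemma hermite_coeff_1_0_formula:
  assumes x: "0 \<le> x"
  shows "set_integrable lborel {gam0 \<alpha> \<beta><..<pi / 2}
        (\<lambda>\<gamma>. exp (- (x powr (\<alpha> / (\<alpha> - 1))) * a_fun \<alpha> \<beta> \<gamma>) * inv Phi (1 / pi * (\<gamma> + pi / 2)))"
      (is "set_integrable lborel ?A ?f")
    and "hermite_coeff M Z1 Z2 \<alpha> 1 0 x \<beta> =
        - (1 / pi) * (LBINT \<gamma>:{gam0 \<alpha> \<beta><..<pi / 2}.
          exp (- (x powr (\<alpha> / (\<alpha> - 1))) * a_fun \<alpha> \<beta> \<gamma>) * inv Phi (1 / pi * (\<gamma> + pi / 2)))"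
proof -
  \<comment> \<open>Cutting \<open>inv Phi\<close> off outside the open unit interval changes nothing here and makes
    the integrand visibly measurable.\<close>
  have quantile_arg: "0 < 1 / pi * (\<gamma> + pi / 2)" "1 / pi * (\<gamma> + pi / 2) < 1" if "\<gamma> \<in> ?A" for \<gamma>
    using that gam0_bounds[OF \<alpha> \<beta>] by (auto simp: field_simps)
  have "(\<lambda>\<gamma>. indicator ?A \<gamma> * ?f \<gamma>) = (\<lambda>\<gamma>. indicator ?A \<gamma> *
      (exp (- (x powr (\<alpha> / (\<alpha> - 1))) * a_fun \<alpha> \<beta> \<gamma>) *
      (inv Phi (1 / pi * (\<gamma> + pi / 2)) * indicator {0<..<1} (1 / pi * (\<gamma> + pi / 2)))))"
  proof
    show "indicator ?A \<gamma> * ?f \<gamma> = indicator ?A \<gamma> *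
      (exp (- (x powr (\<alpha> / (\<alpha> - 1))) * a_fun \<alpha> \<beta> \<gamma>) *
      (inv Phi (1 / pi * (\<gamma> + pi / 2)) * indicator {0<..<1} (1 / pi * (\<gamma> + pi / 2))))" for \<gamma>
      using quantile_arg[of \<gamma>]
      by (cases "\<gamma> \<in> ?A")
        (simp_all only: indicator_simps greaterThanLessThan_iff simp_thms mult_1_right mult_zero_left)
  qed
  also have "\<dots> \<in> borel_measurable borel"
    by measurable
  finally have meas: "(\<lambda>\<gamma>. indicator ?A \<gamma> * ?f \<gamma>) \<in> borel_measurable borel" .
  have f_gam: "exp (- (x powr (\<alpha> / (\<alpha> - 1))) * a_fun \<alpha> \<beta> (gam z)) * z = ?f (gam z)" for z
    by (simp only: quantile_gam)
  note normal = hermite_coeff_1_0_normal[OF x, unfolded f_gam]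
  note subst = gam_substitution[OF meas less_imp_le[OF gam0_bounds(1)[OF \<alpha> \<beta>]] normal(1)]
  show "set_integrable lborel ?A ?f"
    by (rule subst(1))
  show "hermite_coeff M Z1 Z2 \<alpha> 1 0 x \<beta> = - (1 / pi) * (LBINT \<gamma>:?A. ?f \<gamma>)"
    unfolding normal(2) subst(2) by simp
qed

lemma hermite_coeff_0_1_formula:
  assumes x: "0 \<le> x"
  shows "set_integrable lborel {gam0 \<alpha> \<beta><..<pi / 2}
        (\<lambda>\<gamma>. phi_quantile (1 - exp (- (x powr (\<alpha> / (\<alpha> - 1))) * a_fun \<alpha> \<beta> \<gamma>)))"
      (is "set_integrable lborel ?A ?f")
    and "hermite_coeff M Z1 Z2 \<alpha> 0 1 x \<beta> =
        - (1 / pi) * (LBINT \<gamma>:{gam0 \<alpha> \<beta><..<pi / 2}.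
          phi_quantile (1 - exp (- (x powr (\<alpha> / (\<alpha> - 1))) * a_fun \<alpha> \<beta> \<gamma>)))"
proof -
  have meas: "(\<lambda>\<gamma>. indicator ?A \<gamma> * ?f \<gamma>) \<in> borel_measurable borel"
    by measurable
  note normal = hermite_coeff_0_1_normal[OF x]
  note subst = gam_substitution[OF meas less_imp_le[OF gam0_bounds(1)[OF \<alpha> \<beta>]] normal(1)]
  show "set_integrable lborel ?A ?f"
    by (rule subst(1))
  show "hermite_coeff M Z1 Z2 \<alpha> 0 1 x \<beta> = - (1 / pi) * (LBINT \<gamma>:?A. ?f \<gamma>)"
    unfolding normal(2) subst(2) by simp
qed

text \<open>
  The sign changes twice: once in the factor \<open>z1\<close> under \<open>z1 \<mapsto> - z1\<close>, and once by passing to the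
  complementary event, whose constant \<open>1\<close> contributes nothing as \<open>z1\<close> has mean zero.
\<close>

lemma hermite_coeff_1_0_reflect:
  assumes x: "x < 0"
  shows "hermite_coeff M Z1 Z2 \<alpha> 1 0 x \<beta> = hermite_coeff M Z1 Z2 \<alpha> 1 0 (- x) (- \<beta>)"
proof -
  define S :: "real \<Rightarrow> real \<Rightarrow> real \<Rightarrow> real"
    where "S y b z1 = (\<integral>z2. indicator {..y} (G0 \<alpha> b z1 z2) \<partial>N)" for y b z1
  have int: "integrable N (\<lambda>z1. z1 * S y b z1)" for y b
    using NN.integrable_fst'[OF integrable_indicator_G0(1)[of y \<alpha> b]]
    by (simp add: S_def mult.commute)
  have ind_int: "integrable N (\<lambda>z2. indicator {..y} (G0 \<alpha> b z1 z2) :: real)" for y b z1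
    by (rule N.integrable_const_bound[where B = 1]) (auto simp: indicator_def)
  have S_reflect: "S x \<beta> (- z1) = 1 - S (- x) (- \<beta>) z1" for z1
  proof -
    have "S x \<beta> (- z1) = (\<integral>z2. 1 - indicator {..- x} (G0 \<alpha> (- \<beta>) z1 z2) \<partial>N)"
      unfolding S_def by (rule integral_cong_AE) (use AE_indicator_G0_reflect[OF \<alpha> \<beta> x] in auto)
    then show ?thesis
      using ind_int[of "- x" "- \<beta>" z1] N.prob_space by (simp add: S_def)
  qed
  have "(\<integral>z1. z1 * S x \<beta> z1 \<partial>N) = (\<integral>z1. - z1 * S x \<beta> (- z1) \<partial>N)"
    using borel_measurable_integrable[OF int[of x \<beta>]]
    by (intro integral_normal_uminus[symmetric]) simp
  also have "\<dots> = (\<integral>z1. z1 * S (- x) (- \<beta>) z1 - z1 \<partial>N)"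
    unfolding S_reflect by (simp add: algebra_simps)
  also have "\<dots> = (\<integral>z1. z1 * S (- x) (- \<beta>) z1 \<partial>N)"
    using int[of "- x" "- \<beta>"] integrable_normal_id by (simp add: integral_normal_id)
  finally show ?thesis
    unfolding hermite_coeff_1_0_iterated S_def .
qed

text \<open>
  Here the factor \<open>z2\<close> is untouched by \<open>z1 \<mapsto> - z1\<close>, so the complement is the only source of
  a sign.
\<close>

lemma hermite_coeff_0_1_reflect:
  assumes x: "x < 0"
  shows "hermite_coeff M Z1 Z2 \<alpha> 0 1 x \<beta> = - hermite_coeff M Z1 Z2 \<alpha> 0 1 (- x) (- \<beta>)"
proof -
  define T :: "real \<Rightarrow> real \<Rightarrow> real \<Rightarrow> real"
    where "T y b z1 = (\<integral>z2. indicator {..y} (G0 \<alpha> b z1 z2) * z2 \<partial>N)" for y b z1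
  have int: "integrable N (T y b)" for y b
    using NN.integrable_fst'[OF integrable_indicator_G0(2)[of y \<alpha> b]]
    by (simp add: T_def[abs_def])
  have T_reflect: "T x \<beta> (- z1) = - T (- x) (- \<beta>) z1" for z1
  proof -
    have ind_int: "integrable N (\<lambda>z2. indicator {..- x} (G0 \<alpha> (- \<beta>) z1 z2) * z2)"
      by (rule Bochner_Integration.integrable_bound[OF integrable_normal_id]) (auto simp: indicator_def)
    have "AE z2 in N. indicator {..x} (G0 \<alpha> \<beta> (- z1) z2) * z2 =
        z2 - indicator {..- x} (G0 \<alpha> (- \<beta>) z1 z2) * z2"
      using AE_indicator_G0_reflect[OF \<alpha> \<beta> x, of z1]
      by (rule eventually_mono) (simp only: left_diff_distrib mult_1_left)
    then have "T x \<beta> (- z1) = (\<integral>z2. z2 - indicator {..- x} (G0 \<alpha> (- \<beta>) z1 z2) * z2 \<partial>N)"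
      unfolding T_def by (intro integral_cong_AE) auto
    then show ?thesis
      using ind_int integrable_normal_id by (simp add: T_def integral_normal_id)
  qed
  have "(\<integral>z1. T x \<beta> z1 \<partial>N) = (\<integral>z1. T x \<beta> (- z1) \<partial>N)"
    using borel_measurable_integrable[OF int[of x \<beta>]]
    by (intro integral_normal_uminus[symmetric]) simp
  also have "\<dots> = - (\<integral>z1. T (- x) (- \<beta>) z1 \<partial>N)"
    unfolding T_reflect by simp
  finally show ?thesis
    unfolding hermite_coeff_0_1_iterated T_def .
qed

lemma gam0_threshold:
  "\<exists>q. \<forall>z. gam0 \<alpha> \<beta> < gam z \<longleftrightarrow> q < z"
proof -
  let ?p = "(gam0 \<alpha> \<beta> + pi / 2) / pi"
  have "Phi (inv Phi ?p) = ?p"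
    using gam0_bounds[OF \<alpha> \<beta>] by (intro Phi_inv) (auto simp: field_simps)
  then have "gam0 \<alpha> \<beta> = gam (inv Phi ?p)"
    by (simp add: gam_def)
  then obtain q where "gam0 \<alpha> \<beta> = gam q"
    by blast
  then show ?thesis
    by (auto simp: gam_less_iff)
qed

text \<open>
  The integrand is nonnegative, and strictly positive on the half-line \<open>z > q\<close> where
  \<open>gam z > gam0 \<alpha> \<beta>\<close>. That half-line has positive probability, because \<open>gam0 \<alpha> \<beta> < \<pi> / 2\<close>.
\<close>

lemma hermite_coeff_0_1_neg:
  assumes x: "0 < x"
  shows "hermite_coeff M Z1 Z2 \<alpha> 0 1 x \<beta> < 0"
proof -
  let ?f = "\<lambda>z. indicator {gam0 \<alpha> \<beta><..} (gam z) *
      phi_quantile (1 - exp (- (x powr (\<alpha> / (\<alpha> - 1))) * a_fun \<alpha> \<beta> (gam z)))"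
  note normal = hermite_coeff_0_1_normal[OF less_imp_le[OF x]]
  obtain q where q: "\<And>z. gam0 \<alpha> \<beta> < gam z \<longleftrightarrow> q < z"
    using gam0_threshold by blast
  have nonneg: "0 \<le> ?f z" for z
    using phi_quantile_nonneg by simp
  have "\<not> (AE z in N. ?f z = 0)"
  proof
    assume "AE z in N. ?f z = 0"
    then have "AE z in N. z \<in> {..q}"
    proof (rule eventually_mono)
      fix z assume "?f z = 0"
      moreover have "0 < ?f z" if "q < z"
        using that q[of z] a_fun_pos[OF \<alpha> \<beta> _ gam_bounds(2), of z] x
        by (auto intro!: phi_quantile_pos)
      ultimately show "z \<in> {..q}" by fastforce
    qed
    then have "measure N {..q} = 1"
      by (subst N.prob_eq_1) auto
    then show False
      using Phi_bounds(2)[of q] by (simp add: cdf_def)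
  qed
  then have "(\<integral>z. ?f z \<partial>N) \<noteq> 0"
    using integral_nonneg_eq_0_iff_AE[OF normal(1)] nonneg by blast
  moreover have "0 \<le> (\<integral>z. ?f z \<partial>N)"
    by (rule integral_nonneg_AE) (use nonneg in auto)
  ultimately show ?thesis
    unfolding normal(2) by linarith
qed

text \<open>
  At \<open>x = 0\<close> the exponential factor is \<open>1\<close>, so the coefficient is minus the integral of \<open>z \<phi>(z)\<close> over a
  half-line \<open>z > q\<close>, which is \<open>- \<phi>(q)\<close>.
\<close>

lemma hermite_coeff_1_0_at_0_neg: "hermite_coeff M Z1 Z2 \<alpha> 1 0 0 \<beta> < 0"
proof -
  obtain q where q: "\<And>z. gam0 \<alpha> \<beta> < gam z \<longleftrightarrow> q < z"
    using gam0_threshold by blast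
  have "hermite_coeff M Z1 Z2 \<alpha> 1 0 0 \<beta> = - (\<integral>z. z - indicator {..q} z * z \<partial>N)"
    unfolding hermite_coeff_1_0_normal(2)[OF order_refl]
    by (intro arg_cong[where f = uminus] Bochner_Integration.integral_cong)
      (use q in \<open>auto simp: indicator_def\<close>)
  also have "\<dots> = - std_normal_density q"
    using integrable_normal_id integrable_normal_indicator_times_id[of "{..q}"]
    by (simp add: integral_normal_id normal_truncated_mean)
  also have "\<dots> < 0"
    by (simp add: normal_density_pos)
  finally show ?thesis .
qed

end

lemma hermite_rank_eq_1:
  assumes "hermite_coeff M Z1 Z2 \<alpha> 1 0 x \<beta> \<noteq> 0 \<or> hermite_coeff M Z1 Z2 \<alpha> 0 1 x \<beta> \<noteq> 0"
  shows "hermite_rank M Z1 Z2 \<alpha> x \<beta> = 1"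
  unfolding hermite_rank_def
proof (rule antisym)
  show "Inf {enat (m1 + m2) |m1 m2. 1 \<le> m1 + m2 \<and> hermite_coeff M Z1 Z2 \<alpha> m1 m2 x \<beta> \<noteq> 0} \<le> 1"
  proof (rule Inf_lower)
    from assms show "1 \<in> {enat (m1 + m2) |m1 m2. 1 \<le> m1 + m2 \<and> hermite_coeff M Z1 Z2 \<alpha> m1 m2 x \<beta> \<noteq> 0}"
    proof
      assume "hermite_coeff M Z1 Z2 \<alpha> 1 0 x \<beta> \<noteq> 0"
      then show ?thesis
        by (intro CollectI exI[of _ "1::nat"] exI[of _ "0::nat"]) (simp add: one_enat_def)
    next
      assume "hermite_coeff M Z1 Z2 \<alpha> 0 1 x \<beta> \<noteq> 0"
      then show ?thesis
        by (intro CollectI exI[of _ "0::nat"] exI[of _ "1::nat"]) (simp add: one_enat_def)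
    qed
  qed
  show "1 \<le> Inf {enat (m1 + m2) |m1 m2. 1 \<le> m1 + m2 \<and> hermite_coeff M Z1 Z2 \<alpha> m1 m2 x \<beta> \<noteq> 0}"
    by (rule Inf_greatest) (auto simp: one_enat_def)
qed

end

theorem theorem3:
  fixes M :: "'a measure" and Z1 Z2 :: "'a \<Rightarrow> real" and \<alpha> \<beta>\<^sub>2 :: real
  assumes "1 < \<alpha>" and "\<alpha> < 2" and "- 1 \<le> \<beta>\<^sub>2" and "\<beta>\<^sub>2 \<le> 1"
  assumes "prob_space M"
    and "distributed M lborel Z1 std_normal_density"
    and "distributed M lborel Z2 std_normal_density"
    and "prob_space.indep_var M borel Z1 borel Z2"
  shows "(\<forall>x. hermite_rank M Z1 Z2 \<alpha> x \<beta>\<^sub>2 = 1) \<and>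
    (\<forall>x\<ge>0.
      set_integrable lborel {gam0 \<alpha> \<beta>\<^sub>2<..<pi / 2}
        (\<lambda>\<gamma>. exp (- (x powr (\<alpha> / (\<alpha> - 1))) * a_fun \<alpha> \<beta>\<^sub>2 \<gamma>) * inv Phi (1 / pi * (\<gamma> + pi / 2))) \<and>
      hermite_coeff M Z1 Z2 \<alpha> 1 0 x \<beta>\<^sub>2 =
        - (1 / pi) * (LBINT \<gamma>:{gam0 \<alpha> \<beta>\<^sub>2<..<pi / 2}.
          exp (- (x powr (\<alpha> / (\<alpha> - 1))) * a_fun \<alpha> \<beta>\<^sub>2 \<gamma>) * inv Phi (1 / pi * (\<gamma> + pi / 2))) \<and>
      set_integrable lborel {gam0 \<alpha> \<beta>\<^sub>2<..<pi / 2}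
        (\<lambda>\<gamma>. phi_quantile (1 - exp (- (x powr (\<alpha> / (\<alpha> - 1))) * a_fun \<alpha> \<beta>\<^sub>2 \<gamma>))) \<and>
      hermite_coeff M Z1 Z2 \<alpha> 0 1 x \<beta>\<^sub>2 =
        - (1 / pi) * (LBINT \<gamma>:{gam0 \<alpha> \<beta>\<^sub>2<..<pi / 2}.
          phi_quantile (1 - exp (- (x powr (\<alpha> / (\<alpha> - 1))) * a_fun \<alpha> \<beta>\<^sub>2 \<gamma>)))) \<and>
    (\<forall>x<0.
      hermite_coeff M Z1 Z2 \<alpha> 1 0 x \<beta>\<^sub>2 = hermite_coeff M Z1 Z2 \<alpha> 1 0 (- x) (- \<beta>\<^sub>2) \<and>
      hermite_coeff M Z1 Z2 \<alpha> 1 0 (- x) (- \<beta>\<^sub>2) =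
        - (1 / pi) * (LBINT \<gamma>:{gam0 \<alpha> (- \<beta>\<^sub>2)<..<pi / 2}.
          exp (- ((- x) powr (\<alpha> / (\<alpha> - 1))) * a_fun \<alpha> (- \<beta>\<^sub>2) \<gamma>) * inv Phi (1 / pi * (\<gamma> + pi / 2))) \<and>
      hermite_coeff M Z1 Z2 \<alpha> 0 1 x \<beta>\<^sub>2 = - hermite_coeff M Z1 Z2 \<alpha> 0 1 (- x) (- \<beta>\<^sub>2) \<and>
      hermite_coeff M Z1 Z2 \<alpha> 0 1 (- x) (- \<beta>\<^sub>2) =
        - (1 / pi) * (LBINT \<gamma>:{gam0 \<alpha> (- \<beta>\<^sub>2)<..<pi / 2}.
          phi_quantile (1 - exp (- ((- x) powr (\<alpha> / (\<alpha> - 1))) * a_fun \<alpha> (- \<beta>\<^sub>2) \<gamma>))))"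
proof -
  have \<beta>': "- 1 \<le> - \<beta>\<^sub>2" "- \<beta>\<^sub>2 \<le> 1"
    using assms(3,4) by auto
  note normal_pair = assms(5-8)
  note params = assms(1-4) and params' = assms(1,2) \<beta>'
  note J10 = hermite_coeff_1_0_formula[OF normal_pair params]
    and J01 = hermite_coeff_0_1_formula[OF normal_pair params]
    and J10' = hermite_coeff_1_0_formula[OF normal_pair params']
    and J01' = hermite_coeff_0_1_formula[OF normal_pair params']
    and R10 = hermite_coeff_1_0_reflect[OF normal_pair params]
    and R01 = hermite_coeff_0_1_reflect[OF normal_pair params]
  have rank: "hermite_rank M Z1 Z2 \<alpha> x \<beta>\<^sub>2 = 1" for x
  proof (rule hermite_rank_eq_1[OF normal_pair])
    consider "x < 0" | "x = 0" | "0 < x" by linarith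
    then show "hermite_coeff M Z1 Z2 \<alpha> 1 0 x \<beta>\<^sub>2 \<noteq> 0 \<or> hermite_coeff M Z1 Z2 \<alpha> 0 1 x \<beta>\<^sub>2 \<noteq> 0"
    proof cases
      case 1
      then show ?thesis
        using R01[OF 1] hermite_coeff_0_1_neg[OF normal_pair params', of "- x"] by linarith
    next
      case 2
      then show ?thesis
        using hermite_coeff_1_0_at_0_neg[OF normal_pair params] by fastforce
    next
      case 3
      then show ?thesis
        using hermite_coeff_0_1_neg[OF normal_pair params, of x] by linarith
    qed
  qed
  show ?thesis
  proof (intro conjI allI impI)
    show "hermite_rank M Z1 Z2 \<alpha> x \<beta>\<^sub>2 = 1" for x
      by (rule rank)
  qed (rule J10 J01 R10 R01 J10' J01'; simp)+
qed

end
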